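(* Let $n,m,k$ be positive integers such that $1<m<n$, $k=n-m$, and $a=\frac{m(n-m+1)}{n}$ is an integer, and let $b=n-m+1$. Then there exists an $(a,b)$-regular bipartite graph of order $(n,m)$ that is biregular $k$-critical bipartite.
   Context: All graphs are finite, simple and undirected. A bipartite graph $G=(U,V;E)$ has color classes $U,V$ and edge set $E$; it is of order $(n,m)$ if $|U|=n$ and $|V|=m$. It is $(a,b)$-regular if every vertex of $U$ has degree $a$ and every vertex of $V$ has degree $b$. For $1<m<n$, $k=n-m$, $b=n-m+1$ and $a=\frac{m(n-m+1)}{n}$ an integer, an $(a,b)$-regular bipartite graph $G=(U,V;E)$ of order $(n,m)$ is called biregular $k$-critical bipartite if, for every $U'\subset U$ with $|U'|=m$, the subgraph $G[U',V]$ induced in $G$ by $U'\cup V$ has a perfect matching. *)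

theory Defs
  imports Complex_Main
begin

text \<open>
  Edges of a simple undirected graph are two-element sets of vertices.
  A bipartite graph is given by its colour classes \<open>U\<close>, \<open>V\<close> and its edge set \<open>E\<close>;
  disjointness of the colour classes makes every \<open>{u, v}\<close> below a genuine two-element set.
\<close>

definition bipartite_graph :: "'a set \<Rightarrow> 'a set \<Rightarrow> 'a set set \<Rightarrow> bool" where
  "bipartite_graph U V E \<longleftrightarrow>
     finite U \<and> finite V \<and> U \<inter> V = {} \<and> (\<forall>e\<in>E. \<exists>u\<in>U. \<exists>v\<in>V. e = {u, v})"

definition bipartite_of_order :: "nat \<Rightarrow> nat \<Rightarrow> 'a set \<Rightarrow> 'a set \<Rightarrow> 'a set set \<Rightarrow> bool" where
  "bipartite_of_order n m U V E \<longleftrightarrow> bipartite_graph U V E \<and> card U = n \<and> card V = m"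

definition degree :: "'a set set \<Rightarrow> 'a \<Rightarrow> nat" where
  "degree E x = card {e \<in> E. x \<in> e}"

definition biregular :: "nat \<Rightarrow> nat \<Rightarrow> 'a set \<Rightarrow> 'a set \<Rightarrow> 'a set set \<Rightarrow> bool" where
  "biregular a b U V E \<longleftrightarrow> (\<forall>u\<in>U. degree E u = a) \<and> (\<forall>v\<in>V. degree E v = b)"

definition induced_edges :: "'a set set \<Rightarrow> 'a set \<Rightarrow> 'a set set" where
  "induced_edges E W = {e \<in> E. e \<subseteq> W}"

definition matching :: "'a set set \<Rightarrow> 'a set set \<Rightarrow> bool" where
  "matching E M \<longleftrightarrow> M \<subseteq> E \<and> pairwise disjnt M"

text \<open>Here \<open>W\<close> is the vertex set and \<open>E\<close> the edge set of the graph, so \<open>E \<subseteq> Pow W\<close>.\<close>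

definition has_perfect_matching :: "'a set \<Rightarrow> 'a set set \<Rightarrow> bool" where
  "has_perfect_matching W E \<longleftrightarrow> (\<exists>M. matching E M \<and> \<Union>M = W)"

text \<open>
  The parameters \<open>n\<close>, \<open>m\<close>, \<open>a\<close>, \<open>b\<close> are determined by the graph and are therefore
  quantified existentially. That \<open>m (n - m + 1) / n\<close> is an integer is expressed by its
  being equal to the natural number \<open>a\<close>.
\<close>

definition biregular_critical_bipartite ::
    "nat \<Rightarrow> 'a set \<Rightarrow> 'a set \<Rightarrow> 'a set set \<Rightarrow> bool" where
  "biregular_critical_bipartite k U V E \<longleftrightarrow>
     (\<exists>n m a b. 1 < m \<and> m < n \<and> k = n - m \<and> b = n - m + 1 \<and>
        real a = real m * (real n - real m + 1) / real n \<and>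
        bipartite_of_order n m U V E \<and> biregular a b U V E \<and>
        (\<forall>U'\<subseteq>U. card U' = m \<longrightarrow>
           has_perfect_matching (U' \<union> V) (induced_edges E (U' \<union> V))))"

end

theory Submission
  imports Defs "HOL-Library.Infinite_Set"
begin

text \<open>
  Let \<open>d = gcd n b\<close> and \<open>c = m d / n\<close>, which is an integer because \<open>n a = m b\<close>. Take \<open>U\<close> to be the
  integers modulo \<open>n\<close> and \<open>V\<close> the set \<open>P\<close> of residues that are less than \<open>c\<close> modulo \<open>d\<close>, and
  join \<open>p\<close> in \<open>P\<close> to \<open>p, p + 1, \<dots>, p + b - 1\<close>. Since \<open>P\<close> has period \<open>d\<close> and \<open>d\<close> divides \<open>b\<close>, every
  cyclic interval of length \<open>b\<close> meets \<open>P\<close> in \<open>c b / d = a\<close> points, so the graph is biregular.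

  For the matchings only \<open>card P = m\<close> matters. Given \<open>m\<close> residues \<open>U'\<close>, cut the cycle at a point
  where the excess of \<open>P\<close> over \<open>U'\<close> counted so far is minimal. After that cut every initial segment
  has at least as many points of \<open>P\<close> as of \<open>U'\<close>, so matching both sets in increasing order sends
  each point of \<open>P\<close> forward, and by at most \<open>n - m = b - 1\<close> steps.
\<close>

section \<open>Residue counts in windows of consecutive integers\<close>

text \<open>Any \<open>n\<close> consecutive integers form a complete residue system. This allows
  the cycle to be cut at any \<open>z\<close> and unrolled into an interval.\<close>

lemma bij_betw_mod_window:
  fixes n z :: nat
  assumes "X \<subseteq> {..<n}"
  shows "bij_betw (\<lambda>x. x mod n) {x \<in> {z..<z+n}. x mod n \<in> X} X"
proof (cases "n = 0")
  case True
  then show ?thesis using assms by (auto simp: bij_betw_def)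
next
  case False
  have inj: "inj_on (\<lambda>x. x mod n) {z..<z+n}"
  proof (rule inj_onI)
    fix x y assume xy: "x \<in> {z..<z+n}" "y \<in> {z..<z+n}" "x mod n = y mod n"
    have le: "x = y" if "x \<le> y" "x mod n = y mod n" "y < x + n" for x y :: nat
    proof -
      have "n dvd y - x" using that by (metis mod_eq_dvd_iff_nat)
      moreover have "y - x < n" using that by simp
      ultimately show ?thesis using that nat_dvd_not_less by fastforce
    qed
    show "x = y"
    proof (cases "x \<le> y")
      case True
      show ?thesis by (rule le[OF True]) (use xy in auto)
    next
      case False
      have "y = x" by (rule le) (use xy False in auto)
      then show ?thesis ..
    qed
  qed
  then have "card ((\<lambda>x. x mod n) ` {z..<z+n}) = n"
    by (simp add: card_image)
  moreover have "(\<lambda>x. x mod n) ` {z..<z+n} \<subseteq> {..<n}"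
    using False by auto
  ultimately have "(\<lambda>x. x mod n) ` {z..<z+n} = {..<n}"
    by (simp add: card_subset_eq)
  then have "bij_betw (\<lambda>x. x mod n) {z..<z+n} {..<n}"
    using inj by (simp add: bij_betw_def)
  then have "bij_betw (\<lambda>x. x mod n) {x \<in> {z..<z+n}. x mod n \<in> X} {y \<in> {..<n}. y \<in> X}"
    by (rule bij_betw_Collect) simp
  moreover have "{y \<in> {..<n}. y \<in> X} = X" using assms by auto
  ultimately show ?thesis by simp
qed

lemma card_mod_window:
  fixes n z :: nat
  assumes "X \<subseteq> {..<n}"
  shows "card {x \<in> {z..<z+n}. x mod n \<in> X} = card X"
  using bij_betw_same_card[OF bij_betw_mod_window[OF assms]] .

text \<open>Peel off one period of length \<open>d\<close> at a time; wherever it starts, it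
  contributes exactly \<open>c\<close>.\<close>

lemma card_mod_less_window:
  fixes c d q z :: nat
  assumes "c \<le> d"
  shows "card {x \<in> {z..<z+q*d}. x mod d < c} = q * c"
proof (induction q)
  case 0
  show ?case by simp
next
  case (Suc q)
  have "card {x \<in> {z..<z+Suc q*d}. x mod d < c} =
      card ({x \<in> {z..<z+q*d}. x mod d < c} \<union> {x \<in> {z+q*d..<z+q*d+d}. x mod d \<in> {..<c}})"
    by (rule arg_cong[of _ _ card]) auto
  also have "\<dots> =
      card {x \<in> {z..<z+q*d}. x mod d < c} + card {x \<in> {z+q*d..<z+q*d+d}. x mod d \<in> {..<c}}"
    by (rule card_Un_disjoint) auto
  also have "card {x \<in> {z+q*d..<z+q*d+d}. x mod d \<in> {..<c}} = card {..<c}"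
    using assms by (intro card_mod_window) simp
  finally show ?case unfolding Suc by simp
qed

section \<open>Bijections that move every point a bounded distance forward\<close>

text \<open>
  The \<open>i\<close>-th element of \<open>X\<close> is at least \<open>r + i\<close> and the \<open>i\<close>-th element of \<open>Y\<close> is at most
  \<open>r + i + (n - m)\<close>, so the increasing bijection displaces no point by more than \<open>n - m\<close>.
\<close>

lemma increasing_bij_bounded_displacement:
  fixes X Y :: "nat set"
  assumes X: "X \<subseteq> {r..<r+n}" and Y: "Y \<subseteq> {r..<r+n}"
    and card: "card X = m" "card Y = m"
    and dom: "\<And>y. card {x \<in> Y. x < y} \<le> card {x \<in> X. x < y}"
  shows "\<exists>f. bij_betw f X Y \<and> (\<forall>x\<in>X. x \<le> f x \<and> f x \<le> x + (n - m))"
proof -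
  have fin: "finite X" "finite Y" using X Y finite_subset by blast+
  obtain p where p: "bij_betw p {..<m} X" "strict_mono_on {..<m} p"
    using ex_bij_betw_strict_mono_card[OF fin(1)] card by auto
  obtain u where u: "bij_betw u {..<m} Y" "strict_mono_on {..<m} u"
    using ex_bij_betw_strict_mono_card[OF fin(2)] card by auto
  have lower: "r + i \<le> p i" if "i < m" for i
    using that
  proof (induction i)
    case 0
    then show ?case using p(1) X by (force dest: bij_betwE)
  next
    case (Suc i)
    then have "p i < p (Suc i)" using p(2) by (auto intro: strict_mono_onD)
    then show ?case using Suc by simp
  qed
  \<comment> \<open>The index runs down from the largest element of \<open>Y\<close>, which lies
    below \<open>r + n\<close>.\<close>
  have upper: "u (m - Suc j) + Suc j \<le> r + n" if "j < m" for j
    using that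
  proof (induction j)
    case 0
    then have "u (m - 1) \<in> Y" using u(1) by (auto dest: bij_betwE)
    then show ?case using Y by auto
  next
    case (Suc j)
    then have "u (m - Suc (Suc j)) < u (m - Suc j)"
      by (intro strict_mono_onD[OF u(2)]) auto
    then show ?case using Suc by simp
  qed
  \<comment> \<open>Otherwise \<open>Y\<close> has at least \<open>i + 1\<close> points up to
    \<open>u i\<close> and \<open>X\<close> at most \<open>i\<close>, contrary to
    \<open>dom\<close>.\<close>
  have le: "p i \<le> u i" if i: "i < m" for i
  proof (rule ccontr)
    assume less: "\<not> p i \<le> u i"
    have "u ` {..i} \<subseteq> {x \<in> Y. x < Suc (u i)}"
      using i u by (auto simp: less_Suc_eq_le strict_mono_on_leD dest: bij_betwE)
    moreover have "card (u ` {..i}) = Suc i"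
      using i u(1) by (subst card_image) (auto simp: bij_betw_def inj_on_def)
    ultimately have "Suc i \<le> card {x \<in> Y. x < Suc (u i)}"
      using card_mono[of "{x \<in> Y. x < Suc (u i)}" "u ` {..i}"] fin(2) by simp
    also have "\<dots> \<le> card {x \<in> X. x < Suc (u i)}" by (rule dom)
    also have "{x \<in> X. x < Suc (u i)} \<subseteq> p ` {..<i}"
    proof
      fix x assume x: "x \<in> {x \<in> X. x < Suc (u i)}"
      then obtain j where j: "j < m" "x = p j"
        using p(1) by (auto simp: bij_betw_def)
      have "j < i"
      proof (rule ccontr)
        assume "\<not> j < i"
        then have "p i \<le> p j" using i j p(2) by (intro strict_mono_on_leD[OF p(2)]) auto
        then show False using less x j by simp
      qed
      then show "x \<in> p ` {..<i}" using j by simp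
    qed
    then have "card {x \<in> X. x < Suc (u i)} \<le> i"
      using surj_card_le[of "{..<i}"] by simp
    finally show False by simp
  qed
  let ?g = "inv_into {..<m} p"
  have g: "bij_betw ?g X {..<m}" using p(1) by (rule bij_betw_inv_into)
  have "x \<le> u (?g x) \<and> u (?g x) \<le> x + (n - m)" if "x \<in> X" for x
  proof -
    define i where "i = ?g x"
    have i: "i < m" "p i = x"
      using g p(1) that by (auto simp: i_def bij_betw_inv_into_right dest: bij_betwE)
    have "u i + (m - i) \<le> r + n" using upper[of "m - Suc i"] i by (simp add: Suc_diff_Suc)
    then show ?thesis using lower[of i] le[of i] i unfolding i_def[symmetric] by simp
  qed
  moreover have "bij_betw (u \<circ> ?g) X Y" using g u(1) by (rule bij_betw_trans)
  ultimately show ?thesis by (intro exI[of _ "u \<circ> ?g"]) auto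
qed

text \<open>Unrolling at a suitable cut \<open>r\<close> reduces this to the linear case;
  \<open>(f x + n - x) mod n\<close> counts the forward steps from \<open>x\<close> to
  \<open>f x\<close> on the cycle.\<close>

lemma cyclic_bij_bounded_displacement:
  fixes X Y :: "nat set"
  assumes X: "X \<subseteq> {..<n}" and Y: "Y \<subseteq> {..<n}" and card: "card X = m" "card Y = m"
    and "0 < n"
  shows "\<exists>f. bij_betw f X Y \<and> (\<forall>x\<in>X. (f x + n - x) mod n \<le> n - m)"
proof -
  define C where "C A y = card {x \<in> {..<y}. x mod n \<in> A}" for A and y :: nat
  have C_add: "C A (z + y) = C A z + card {x \<in> {z..<z+y}. x mod n \<in> A}" for A z y
  proof -
    have "card {x \<in> {..<z+y}. x mod n \<in> A} =
        card ({x \<in> {..<z}. x mod n \<in> A} \<union> {x \<in> {z..<z+y}. x mod n \<in> A})"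
      by (rule arg_cong[of _ _ card]) auto
    also have "\<dots> =
        card {x \<in> {..<z}. x mod n \<in> A} + card {x \<in> {z..<z+y}. x mod n \<in> A}"
      by (rule card_Un_disjoint) auto
    finally show ?thesis unfolding C_def .
  qed
  \<comment> \<open>The excess may be negative, hence \<open>int\<close>. It has period
    \<open>n\<close> because \<open>X\<close> and \<open>Y\<close> have equal size, so its minimum
    over one period is global.\<close>
  define g where "g y = int (C X y) - int (C Y y)" for y
  have g_add: "g (y + n) = g y" for y
    unfolding g_def C_add card_mod_window[OF X] card_mod_window[OF Y] by (simp add: card)
  have g_mod: "g y = g (y mod n)" for y
  proof (induction y rule: less_induct)
    case (less y)
    show ?case
    proof (cases "y < n")
      case False
      then have "g (y - n) = g ((y - n) mod n)" using less \<open>0 < n\<close> by simp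
      then show ?thesis using g_add[of "y - n"] False by (simp add: le_mod_geq)
    qed simp
  qed
  have "Min (g ` {..<n}) \<in> g ` {..<n}" using \<open>0 < n\<close> by (intro Min_in) auto
  then obtain r where r: "r < n" "g r = Min (g ` {..<n})" by auto
  have min: "g r \<le> g y" for y
    unfolding g_mod[of y] r(2) using \<open>0 < n\<close> by (intro Min_le) auto
  let ?W = "\<lambda>A. {x \<in> {r..<r+n}. x mod n \<in> A}"
  have dom: "card {x \<in> ?W Y. x < y} \<le> card {x \<in> ?W X. x < y}" for y
  proof (cases "y \<le> r")
    case True
    then have "{x \<in> ?W Y. x < y} = {}" by auto
    then show ?thesis by (metis card.empty le0)
  next
    case False
    \<comment> \<open>The cap at \<open>n\<close> covers every \<open>y\<close> beyond the end of
      the window.\<close>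
    define t where "t = min (y - r) n"
    have "{x \<in> ?W A. x < y} = {x \<in> {r..<r+t}. x mod n \<in> A}" for A
      using False by (auto simp: t_def)
    then show ?thesis using min[of "r + t"] by (simp add: g_def C_add)
  qed
  have "\<exists>f. bij_betw f (?W X) (?W Y) \<and> (\<forall>x\<in>?W X. x \<le> f x \<and> f x \<le> x + (n - m))"
    by (rule increasing_bij_bounded_displacement[OF _ _ _ _ dom])
      (use card_mod_window[OF X, of r] card_mod_window[OF Y, of r] card in auto)
  then obtain f where f: "bij_betw f (?W X) (?W Y)"
      "\<And>x. x \<in> ?W X \<Longrightarrow> x \<le> f x \<and> f x \<le> x + (n - m)"
    by blast
  let ?h = "inv_into (?W X) (\<lambda>x. x mod n)"
  have bX: "bij_betw (\<lambda>x. x mod n) (?W X) X" and bY: "bij_betw (\<lambda>x. x mod n) (?W Y) Y"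
    by (rule bij_betw_mod_window[OF X] bij_betw_mod_window[OF Y])+
  have h: "bij_betw ?h X (?W X)" using bX by (rule bij_betw_inv_into)
  have "(f (?h x) mod n + n - x) mod n \<le> n - m" if "x \<in> X" for x
  proof -
    define w where "w = ?h x"
    have w: "w \<in> ?W X" "w mod n = x"
      unfolding w_def using bij_betw_apply[OF h that] bij_betw_inv_into_right[OF bX that] .
    obtain t where t: "f w = w + t" "t \<le> n - m"
      using f(2)[OF w(1)] by (metis le_add_diff_inverse nat_add_left_cancel_le)
    have "x < n" using that X by auto
    then have "(f w mod n + n - x) mod n = (f w + (n - x)) mod n"
      by (metis Nat.add_diff_assoc less_imp_le mod_add_left_eq)
    \<comment> \<open>As \<open>w mod n = x\<close>, the sum \<open>w + (n - x)\<close> is a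
      multiple of \<open>n\<close>; only the shift \<open>t\<close> survives.\<close>
    also have "f w + (n - x) = t + n * Suc (w div n)"
      using t(1) w(2) mult_div_mod_eq[of n w] \<open>x < n\<close> by simp
    also have "\<dots> mod n = t mod n" by (rule mod_mult_self2)
    also have "\<dots> \<le> t" by simp
    finally show ?thesis using t unfolding w_def by simp
  qed
  moreover have "bij_betw ((\<lambda>x. x mod n) \<circ> (f \<circ> ?h)) X Y"
    using bij_betw_trans[OF bij_betw_trans[OF h f(1)] bY] .
  ultimately show ?thesis by (intro exI[of _ "(\<lambda>x. x mod n) \<circ> (f \<circ> ?h)"]) auto
qed

section \<open>The circular graph: degrees and perfect matchings\<close>

text \<open>Residue \<open>p\<close> as a vertex of the second colour class is encoded by \<open>n + p\<close>.\<close>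

definition circular_edges :: "nat \<Rightarrow> nat \<Rightarrow> nat set \<Rightarrow> nat set set" where
  "circular_edges n b P = {{u, n + p} | u p. u < n \<and> p \<in> P \<and> (u + n - p) mod n < b}"

lemma bipartite_circular_edges:
  assumes "P \<subseteq> {..<n}"
  shows "bipartite_graph {..<n} ((+) n ` P) (circular_edges n b P)"
  using assms finite_subset[OF assms]
  unfolding bipartite_graph_def circular_edges_def by auto

lemma cyclic_difference_iff:
  fixes n b p u t :: nat
  assumes "p < n" "b \<le> n" "t < b" "u < n"
  shows "u = (p + t) mod n \<longleftrightarrow> (u + n - p) mod n = t"
proof -
  have t: "t < n" using assms by simp
  show ?thesis
  proof
    assume u: "u = (p + t) mod n"
    show "(u + n - p) mod n = t"
      using assms t unfolding u by (cases "p + t < n") (auto simp: le_mod_geq)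
  next
    assume "(u + n - p) mod n = t"
    then show "u = (p + t) mod n"
      using assms t by (cases "p \<le> u") (auto simp: le_mod_geq)
  qed
qed

lemma degree_circular_edges_right:
  assumes "P \<subseteq> {..<n}" "p \<in> P" "b \<le> n"
  shows "degree (circular_edges n b P) (n + p) = b"
proof -
  have p: "p < n" using assms by auto
  have diff: "((p + t) mod n + n - p) mod n = t" if "t < b" for t
    using cyclic_difference_iff[of p n b t "(p + t) mod n"] p assms(3) that by simp
  have "{e \<in> circular_edges n b P. n + p \<in> e} =
      (\<lambda>u. {u, n + p}) ` {u \<in> {..<n}. (u + n - p) mod n < b}"
    using assms by (auto simp: circular_edges_def)
  moreover have "inj_on (\<lambda>u. {u, n + p}) {u \<in> {..<n}. (u + n - p) mod n < b}"
    by (auto simp: inj_on_def doubleton_eq_iff)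
  moreover have "{u \<in> {..<n}. (u + n - p) mod n < b} = (\<lambda>t. (p + t) mod n) ` {..<b}"
    using p diff cyclic_difference_iff[of p n b] assms(3) by (auto simp: image_iff)
  moreover have "inj_on (\<lambda>t. (p + t) mod n) {..<b}"
    by (rule inj_on_inverseI[of _ "\<lambda>u. (u + n - p) mod n"]) (simp add: diff)
  ultimately show ?thesis
    unfolding degree_def by (simp add: card_image)
qed

text \<open>The neighbours of \<open>u\<close> come from the points of \<open>P\<close> among the
  \<open>b\<close> residues ending at \<open>u\<close>; raising the window by \<open>n\<close> keeps
  the subtraction of \<open>b\<close> from truncating.\<close>

lemma degree_circular_edges_left:
  assumes "P \<subseteq> {..<n}" "u < n" "b \<le> n"
  shows "degree (circular_edges n b P) u =
    card {x \<in> {u + n + 1 - b..<u + n + 1}. x mod n \<in> P}"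
proof -
  let ?N = "{p \<in> P. (u + n - p) mod n < b}"
  let ?W = "{x \<in> {u + n + 1 - b..<u + n + 1}. x mod n \<in> P}"
  have "{e \<in> circular_edges n b P. u \<in> e} = (\<lambda>p. {u, n + p}) ` ?N"
    using assms by (auto simp: circular_edges_def)
  moreover have "inj_on (\<lambda>p. {u, n + p}) ?N"
    using assms by (auto simp: inj_on_def doubleton_eq_iff)
  ultimately have "degree (circular_edges n b P) u = card ?N"
    unfolding degree_def by (simp add: card_image)
  moreover have "bij_betw (\<lambda>x. x mod n) ?W ?N"
  proof (rule bij_betw_imageI)
    \<comment> \<open>By \<open>b \<le> n\<close> the window sits inside \<open>n\<close>
      consecutive integers, where reduction is injective.\<close>
    have "?W \<subseteq> {x \<in> {u + 1..<u + 1 + n}. x mod n \<in> P}" using assms by auto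
    then show "inj_on (\<lambda>x. x mod n) ?W"
      using bij_betw_mod_window[OF assms(1), of "u + 1"]
      by (auto simp: bij_betw_def intro: inj_on_subset)
  next
    have "x mod n \<in> ?N" if "x \<in> ?W" for x
    proof -
      have x: "x \<le> u + n" "u + n - x < b" "x mod n \<in> P" using that by auto
      have "u = (x mod n + (u + n - x)) mod n" using x assms(2)
        by (metis le_add_diff_inverse mod_add_left_eq mod_add_self2 mod_less)
      then show ?thesis
        using x assms cyclic_difference_iff[of "x mod n" n b "u + n - x" u] by auto
    qed
    moreover have "p \<in> (\<lambda>x. x mod n) ` ?W" if "p \<in> ?N" for p
    proof -
      define t where "t = (u + n - p) mod n"
      have t: "t < b" "p \<in> P" "p < n" using that assms by (auto simp: t_def)
      have "u = (p + t) mod n"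
        using cyclic_difference_iff[of p n b t u] t assms by (simp add: t_def)
      then have "p = (u + n - t) mod n"
        using t assms by (cases "p + t < n") (auto simp: le_mod_geq)
      then show ?thesis using t assms by (intro image_eqI[of _ _ "u + n - t"]) auto
    qed
    ultimately show "(\<lambda>x. x mod n) ` ?W = ?N" by blast
  qed
  ultimately show ?thesis by (simp add: bij_betw_same_card)
qed

text \<open>Forward shifts of at most \<open>n - m < b\<close> steps are edges, so the cyclic
  bijection is itself the matching.\<close>

lemma perfect_matching_circular_edges:
  assumes P: "P \<subseteq> {..<n}" and U: "U \<subseteq> {..<n}" and card: "card P = m" "card U = m"
    and b: "n - m < b" and "0 < n"
  shows "has_perfect_matching (U \<union> (+) n ` P)
    (induced_edges (circular_edges n b P) (U \<union> (+) n ` P))"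
proof -
  obtain f where f: "bij_betw f P U" "\<And>x. x \<in> P \<Longrightarrow> (f x + n - x) mod n \<le> n - m"
    using cyclic_bij_bounded_displacement[OF P U card \<open>0 < n\<close>] by blast
  have fU: "f x \<in> U" "f x < n" if "x \<in> P" for x
    using f(1) that U by (auto dest: bij_betwE)
  let ?M = "(\<lambda>x. {f x, n + x}) ` P"
  have "?M \<subseteq> induced_edges (circular_edges n b P) (U \<union> (+) n ` P)"
    using fU f(2) b by (fastforce simp: induced_edges_def circular_edges_def)
  moreover have "pairwise disjnt ?M"
  proof (rule pairwiseI)
    fix e e' assume "e \<in> ?M" "e' \<in> ?M" "e \<noteq> e'"
    then obtain x y where "x \<in> P" "y \<in> P" "x \<noteq> y" "e = {f x, n + x}" "e' = {f y, n + y}"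
      by auto
    then show "disjnt e e'"
      using fU(2)[of x] fU(2)[of y] bij_betw_imp_inj_on[OF f(1)] by (auto simp: inj_on_def)
  qed
  moreover have "\<Union> ?M = U \<union> (+) n ` P"
    using f(1) by (auto simp: bij_betw_def)
  ultimately show ?thesis
    unfolding has_perfect_matching_def matching_def by blast
qed

section \<open>Choice of the residues and conclusion\<close>

lemma ex_equidistributed_residues:
  fixes n m a b :: nat
  assumes "n * a = m * b" "m \<le> n" "0 < n" "b \<le> n"
  shows "\<exists>P \<subseteq> {..<n}. card P = m \<and>
    (\<forall>z. card {x \<in> {z..<z+b}. x mod n \<in> P} = a)"
proof -
  define d where "d = gcd n b"
  obtain s q where sq: "n = s * d" "b = q * d" "coprime s q"
    using gcd_coprime_exists[of n b] \<open>0 < n\<close> unfolding d_def by auto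
  have pos: "0 < d" "0 < s" using sq \<open>0 < n\<close> by auto
  have eq: "s * a = m * q" using assms(1) sq pos by (simp add: ac_simps)
  \<comment> \<open>\<open>s\<close> divides \<open>m * q\<close> and is coprime to
    \<open>q\<close>.\<close>
  then have "s dvd m"
    using sq(3) by (metis coprime_dvd_mult_left_iff dvd_triv_left)
  then obtain c where c: "m = s * c" by blast
  have "c \<le> d" using assms(2) c sq pos by simp
  have a: "a = q * c" using eq c pos by (simp add: ac_simps)
  define P where "P = {x \<in> {..<n}. x mod d < c}"
  have "card P = m"
    using card_mod_less_window[OF \<open>c \<le> d\<close>, of 0 s] sq c
    by (simp add: P_def lessThan_atLeast0)
  \<comment> \<open>Reducing modulo \<open>n\<close> first does not change the residue modulo
    \<open>d\<close>, a divisor of \<open>n\<close>.\<close>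
  moreover have "{x \<in> {z..<z+b}. x mod n \<in> P} = {x \<in> {z..<z+q*d}. x mod d < c}" for z
    using \<open>0 < n\<close> sq by (auto simp: P_def mod_mod_cancel)
  ultimately show ?thesis
    using card_mod_less_window[OF \<open>c \<le> d\<close>, of _ q] a
    by (intro exI[of _ P]) (auto simp: P_def)
qed

theorem theorem5p5:
  fixes n m k a b :: nat
  assumes "0 < n" and "0 < m" and "0 < k"
    and "1 < m" and "m < n"
    and "k = n - m"
    and "real a = real m * (real n - real m + 1) / real n"
    and "b = n - m + 1"
  shows "\<exists>(U :: nat set) (V :: nat set) (E :: nat set set).
           bipartite_of_order n m U V E \<and> biregular a b U V E \<and>
           biregular_critical_bipartite k U V E"
proof -
  have "real (n * a) = real (m * b)" using assms by (simp add: field_simps)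
  then have eq: "n * a = m * b" by linarith
  have b: "b \<le> n" "n - m < b" using assms by auto
  obtain P where P: "P \<subseteq> {..<n}" "card P = m"
      "\<And>z. card {x \<in> {z..<z+b}. x mod n \<in> P} = a"
    using ex_equidistributed_residues[OF eq] assms b by auto
  let ?V = "(+) n ` P" and ?E = "circular_edges n b P"
  have order: "bipartite_of_order n m {..<n} ?V ?E"
    using bipartite_circular_edges[OF P(1)] P(2)
    by (simp add: bipartite_of_order_def card_image)
  have "degree ?E u = a" if "u < n" for u
    using degree_circular_edges_left[OF P(1) that b(1)] P(3)[of "u + n + 1 - b"] b by simp
  then have reg: "biregular a b {..<n} ?V ?E"
    using degree_circular_edges_right[OF P(1)] b by (auto simp: biregular_def)
  have "\<forall>U'\<subseteq>{..<n}. card U' = m \<longrightarrow>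
      has_perfect_matching (U' \<union> ?V) (induced_edges ?E (U' \<union> ?V))"
    using perfect_matching_circular_edges[OF P(1)] P(2) b assms by blast
  then have "biregular_critical_bipartite k {..<n} ?V ?E"
    unfolding biregular_critical_bipartite_def using order reg assms by blast
  then show ?thesis using order reg by blast
qed

end
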